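(* There is an absolute constant $c>0$ such that for every integer $n\ge 2$ and every point set $X=\{p_1,\dots,p_n\}$ with $p_i=(i,t_i)$, where $(t_1,\dots,t_n)$ is a permutation of $\{1,\dots,n\}$, the set $Y$ of points added by GreedyArb on input $X$ satisfies $$|X|+|Y|\;\le\; c\,\log n\cdot\bigl(|X|+|\mathrm{MinArb}(X)|\bigr).$$ That is, GreedyArb is $O(\log n)$-competitive.
   Context: Points are in $\mathbb{Z}^2$; the $x$-coordinate of a point $a$ is $a.x$ (the key) and its $y$-coordinate is $a.y$ (the time). For points $a,b$ not on a common horizontal or vertical line, $\Box ab$ denotes the closed axis-parallel rectangle with opposite corners $a$ and $b$. A pair $(a,b)$ of points is arborally satisfied with respect to a point set $P$ if $a$ and $b$ lie on a common horizontal or vertical line, or there exists $r\in P\setminus\{a,b\}$ lying in $\Box ab$ (interior or boundary). A point set $P$ is arborally satisfied if every pair of points of $P$ is arborally satisfied with respect to $P$. $\mathrm{MinArb}(X)$ denotes a minimum-cardinality point set $Y'$ such that $X\cup Y'$ is arborally satisfied. GreedyArb on input $X$: for $t=1,2,\dots,n$ in order, let $p$ be the unique point of $X$ with $p.y=t$, and let $Z_t$ be the set consisting of the points of $X$ with $y$-coordinate $<t$ together with all points added at earlier steps. The algorithm adds the set $M_p=\{(q.x,t): q\in Z_t,\ q.x\neq p.x,\ \text{and } \Box pq \text{ contains no point of } Z_t\cup\{p\} \text{ other than } p,q\}$. The output is $Y=\bigcup_{p\in X}M_p$. *)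

theory Defs
  imports Complex_Main
begin

(* A point is a pair (x, y): the first component is the key, the second one the time. *)
type_synonym point = "int \<times> int"

definition rect :: "point \<Rightarrow> point \<Rightarrow> point set" where
  "rect a b = {min (fst a) (fst b)..max (fst a) (fst b)} \<times> {min (snd a) (snd b)..max (snd a) (snd b)}"

definition arborally_satisfied_pair :: "point set \<Rightarrow> point \<Rightarrow> point \<Rightarrow> bool" where
  "arborally_satisfied_pair P a b \<longleftrightarrow>
     fst a = fst b \<or> snd a = snd b \<or> (\<exists>r \<in> P - {a, b}. r \<in> rect a b)"

definition arborally_satisfied :: "point set \<Rightarrow> bool" where
  "arborally_satisfied P \<longleftrightarrow> (\<forall>a \<in> P. \<forall>b \<in> P. arborally_satisfied_pair P a b)"

(* Minimum-cardinality sets need not be unique, so this is a predicate: Y is a possible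
   value of MinArb(X).  Finiteness is explicit because card is 0 on infinite sets. *)
definition is_MinArb :: "point set \<Rightarrow> point set \<Rightarrow> bool" where
  "is_MinArb X Y \<longleftrightarrow>
     finite Y \<and> arborally_satisfied (X \<union> Y) \<and>
     (\<forall>Y'. finite Y' \<and> arborally_satisfied (X \<union> Y') \<longrightarrow> card Y \<le> card Y')"

lemma ex_is_MinArb:
  assumes "finite X"
  shows "\<exists>Y. is_MinArb X Y"
proof -
  let ?G = "fst ` X \<times> snd ` X"
  let ?Q = "\<lambda>Y. finite Y \<and> arborally_satisfied (X \<union> Y)"
  have "X \<union> ?G = ?G" by force
  moreover have "arborally_satisfied ?G"
    unfolding arborally_satisfied_def
  proof (intro ballI)
    fix a b assume ab: "a \<in> ?G" "b \<in> ?G"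
    have "(fst a, snd b) \<in> ?G \<inter> rect a b" using ab by (simp add: rect_def mem_Times_iff)
    then show "arborally_satisfied_pair ?G a b"
      unfolding arborally_satisfied_pair_def by (cases a; cases b) fastforce
  qed
  ultimately have "?Q ?G" using assms by simp
  from ex_has_least_nat[of ?Q, OF this, of card] show ?thesis
    unfolding is_MinArb_def by blast
qed

(* M_p, where Z is the set of all points strictly below the row of p. *)
definition greedy_row :: "point set \<Rightarrow> point \<Rightarrow> point set" where
  "greedy_row Z p =
     {(fst q, snd p) | q. q \<in> Z \<and> fst q \<noteq> fst p \<and> rect p q \<inter> (Z \<union> {p}) \<subseteq> {p, q}}"

(* The points added in the steps 1, ..., k.  The definite description is only meaningful if X
   has exactly one point in each of the rows 1, ..., k. *)
primrec greedy_added :: "point set \<Rightarrow> nat \<Rightarrow> point set" where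
  "greedy_added X 0 = {}"
| "greedy_added X (Suc k) =
     (let t = int (Suc k);
          p = (THE p. p \<in> X \<and> snd p = t);
          Z = {q \<in> X. snd q < t} \<union> greedy_added X k
      in greedy_added X k \<union> greedy_row Z p)"

definition GreedyArb :: "point set \<Rightarrow> point set" where
  "GreedyArb X = greedy_added X (card X)"

definition perm_points :: "nat \<Rightarrow> (nat \<Rightarrow> nat) \<Rightarrow> point set" where
  "perm_points n t = (\<lambda>i. (int i, int (t i))) ` {1..n}"

end

theory Submission
  imports Defs
begin

text \<open>
  Since \<open>|X| = n\<close>, it suffices that GreedyArb adds \<open>O(n log n)\<close> points on any permutation.
  Let \<open>\<tau> x\<close> be the last time at which column \<open>x\<close> was touched. Accessing \<open>k\<close> touches exactly the
  strict records of \<open>\<tau>\<close> seen when walking away from \<open>k\<close> to the right and to the left. Let the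
  neighbourhood of \<open>x\<close> be the maximal interval around \<open>x\<close> on which \<open>\<tau>\<close> is otherwise smaller than
  \<open>\<tau> x\<close>, and let the potential be the sum of the logarithms of the neighbourhood sizes. If
  \<open>d\<^sub>1 < d\<^sub>2 < \<dots>\<close> are the distances from \<open>k\<close> of the records on one side (and \<open>d\<^sub>0 = 0\<close>), then the
  new neighbourhood of the \<open>i\<close>-th record has fewer than \<open>d\<^bsub>i+1\<^esub> - d\<^bsub>i-1\<^esub>\<close> elements, whereas the old
  neighbourhood of the \<open>(i+1)\<close>-st record had at least \<open>d\<^bsub>i+1\<^esub>\<close>. The comparison has to be made with
  the next record because columns of equal \<open>\<tau>\<close> may make the neighbourhood of a record itself
  grow. So each touched column pays for itself with one unit of potential, except for \<open>O(log n)\<close>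
  columns per access around which the distances double.
\<close>

section \<open>A doubling argument for finite sets of distances\<close>

lemma sum_shift_le:
  fixes D :: "int set" and f g :: "int \<Rightarrow> real"
  assumes fin: "finite D" and ne: "D \<noteq> {}"
    and step: "\<And>d b. \<lbrakk>d \<in> D; b \<in> D; d < b; \<forall>c\<in>D. \<not> (d < c \<and> c < b)\<rbrakk> \<Longrightarrow> f d \<le> g b"
    and g: "\<And>b. b \<in> D \<Longrightarrow> g b \<ge> 0"
  shows "sum f D \<le> f (Max D) + sum g D"
proof -
  define s where "s d = Min {b\<in>D. d < b}" for d
  define E where "E = D - {Max D}"
  have s: "s d \<in> D \<and> d < s d \<and> (\<forall>c\<in>D. d < c \<longrightarrow> s d \<le> c)" if "d \<in> E" for d
  proof -
    have "d < Max D" using that fin E_def by (simp add: order_less_le)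
    then have "{b\<in>D. d < b} \<noteq> {}" using fin ne Max_in by blast
    then have "s d \<in> {b\<in>D. d < b}" unfolding s_def using fin by (intro Min_in) auto
    moreover have "\<forall>c\<in>D. d < c \<longrightarrow> s d \<le> c" unfolding s_def using fin by auto
    ultimately show ?thesis by blast
  qed
  have inj: "inj_on s E"
  proof (rule inj_onI)
    fix x y assume xy: "x \<in> E" "y \<in> E" "s x = s y"
    show "x = y"
      using s[OF xy(1)] s[OF xy(2)] xy E_def by (metis DiffD1 linorder_neqE not_less)
  qed
  have "sum f E \<le> sum (g \<circ> s) E"
  proof (rule sum_mono)
    fix d assume d: "d \<in> E"
    show "f d \<le> (g \<circ> s) d"
      using s[OF d] d E_def step[of d "s d"] by (force simp: not_less)
  qed
  also have "\<dots> = sum g (s ` E)" using inj by (simp add: sum.reindex)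
  also have "\<dots> \<le> sum g D" using s g fin by (intro sum_mono2) auto
  finally show ?thesis using fin ne by (simp add: E_def sum_diff1)
qed

text \<open>The least power of two above \<open>a\<close> works, since its half is at most
  \<open>a\<close>. The \<open>max 1\<close> covers \<open>a = 0\<close>.\<close>

lemma exists_power_between:
  fixes a :: int
  assumes "a \<ge> 0"
  shows "\<exists>j. a < 2 ^ j \<and> 2 ^ j \<le> max 1 (2 * a)"
proof (cases "a = 0")
  case True
  then show ?thesis by (intro exI[of _ 0]) auto
next
  case False
  define j where "j = (LEAST j. a < 2 ^ j)"
  have "a < 2 ^ nat a"
    by (metis assms int_nat_eq of_nat_less_two_power)
  then have 1: "a < 2 ^ j" unfolding j_def by (rule LeastI)
  then have "j \<noteq> 0" using False assms by (intro notI) auto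
  then obtain i where i: "j = Suc i" using not0_implies_Suc by blast
  have "\<not> a < 2 ^ i" using not_less_Least[of i "\<lambda>j. a < 2 ^ j"] i j_def by simp
  then show ?thesis using 1 i by (intro exI[of _ j]) auto
qed

text \<open>If \<open>a < d < b\<close> are consecutive and \<open>b > 2 * a\<close>, then some power of two lies in between,
  and \<open>d\<close> is one of the two elements of \<open>D\<close> next to it; hence all but logarithmically many \<open>d\<close>
  gain a factor of two.\<close>

lemma sum_log_gaps_le:
  fixes D :: "int set" and f g :: "int \<Rightarrow> real" and m :: int
  assumes sub: "D \<subseteq> {1..m}" and m: "m \<ge> 1"
    and f_max: "\<And>d. d \<in> D \<Longrightarrow> f d \<le> log 2 m"
    and f_gap: "\<And>a d b. \<lbrakk>a \<in> insert 0 D; d \<in> D; b \<in> D; a < d; d < b\<rbrakk> \<Longrightarrow> f d \<le> log 2 (b - a - 1)"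
    and g: "\<And>b. b \<in> D \<Longrightarrow> g b \<ge> log 2 b"
  shows "sum f D + card D \<le> sum g D + 3 * log 2 m + 3"
proof (cases "D = {}")
  case True
  then show ?thesis using m by simp
next
  case ne: False
  have fin: "finite D" using sub finite_subset by blast
  define J where "J = {j::nat. 2 ^ j \<le> m}"
  \<comment> \<open>\<open>T\<close> holds the neighbours in \<open>D\<close> of each power of two
    up to \<open>m\<close>. \<open>Max\<close> or \<open>Min\<close> of an empty set may add an
    arbitrary integer, which is harmless: only the cardinality of \<open>T\<close> is
    bounded.\<close>
  define T where "T = (\<lambda>j. Max {c\<in>D. c < 2 ^ j}) ` J \<union> (\<lambda>j. Min {c\<in>D. 2 ^ j \<le> c}) ` J"
  have J_le: "J \<subseteq> {..nat \<lfloor>log 2 m\<rfloor>}"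
  proof
    fix j assume "j \<in> J"
    then have "(2::real) ^ j \<le> m" unfolding J_def
      by (metis mem_Collect_eq of_int_le_iff of_int_numeral of_int_power)
    then have "real j \<le> log 2 m" using m by (simp add: le_log_iff powr_realpow)
    then show "j \<in> {..nat \<lfloor>log 2 m\<rfloor>}" by (simp add: le_floor_iff le_nat_iff)
  qed
  have finJ: "finite J" using J_le finite_subset by blast
  have "card J \<le> Suc (nat \<lfloor>log 2 m\<rfloor>)" using card_mono[OF _ J_le] by simp
  moreover have "real (nat \<lfloor>log 2 m\<rfloor>) \<le> log 2 m" using m by (simp add: of_nat_nat)
  ultimately have cJ: "real (card J) \<le> log 2 m + 1" by linarith
  have "card T \<le> card J + card J"
    unfolding T_def using card_Un_le card_image_le[OF finJ] by (meson add_mono le_trans)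
  then have cT: "real (card T) \<le> 2 * log 2 m + 2" using cJ by linarith
  \<comment> \<open>\<open>u d\<close> is the unit that \<open>d\<close> pays for itself; elements
    of \<open>T\<close> are exempt.\<close>
  define u where "u d = (if d \<in> T then 0 else 1 :: real)" for d
  have "sum (\<lambda>d. f d + u d) D \<le> (f (Max D) + u (Max D)) + sum g D"
  proof (rule sum_shift_le[OF fin ne])
    fix d b assume d: "d \<in> D" and b: "b \<in> D" and db: "d < b"
      and gap: "\<forall>c\<in>D. \<not> (d < c \<and> c < b)"
    \<comment> \<open>The predecessor of \<open>d\<close>, with 0 as predecessor of the least
      element.\<close>
    define a where "a = Max (insert 0 {c\<in>D. c < d})"
    have a: "a \<in> insert 0 {c\<in>D. c < d}" unfolding a_def using fin by (intro Max_in) auto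
    have a_ge: "c \<le> a" if "c \<in> D" "c < d" for c
      unfolding a_def using fin that by (intro Max_ge) auto
    have pos: "a \<ge> 0" "a < d" using a d sub by auto
    have fd: "f d \<le> log 2 (b - a - 1)" using f_gap[of a d b] a d b db pos by auto
    have gb: "log 2 b \<le> g b" by (rule g[OF b])
    show "f d + u d \<le> g b"
    \<comment> \<open>If \<open>b \<le> 2 * a\<close>, then \<open>2 * (b - a - 1) \<le> b\<close>,
      so the logarithm gains a full unit. Otherwise a power of two lies in \<open>{a<..b}\<close>,
      which forces \<open>d\<close> into \<open>T\<close>.\<close>
    proof (cases "b \<le> 2 * a")
      case True
      have "u d \<le> 1" by (simp add: u_def)
      have "log 2 (b - a - 1) + 1 = log 2 (2 * (b - a - 1))"
        using pos db log_mult[of "real_of_int 2" "real_of_int (b - a - 1)" 2]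
        by (simp add: algebra_simps)
      also have "\<dots> \<le> log 2 b"
        using pos db True by (subst log_le_cancel_iff) simp_all
      finally show ?thesis using fd gb \<open>u d \<le> 1\<close> by linarith
    next
      case False
      obtain j where j: "a < 2 ^ j" "2 ^ j \<le> max 1 (2 * a)"
        using exists_power_between pos by blast
      have jb: "2 ^ j \<le> b" using j False pos db by linarith
      then have jJ: "j \<in> J" using b sub unfolding J_def by auto
      have "d = Max {c\<in>D. c < 2 ^ j}" if "d < 2 ^ j"
      proof (rule Max_eqI[symmetric])
        show "c \<le> d" if "c \<in> {c\<in>D. c < 2 ^ j}" for c using that gap jb by fastforce
      qed (use fin that d in auto)
      moreover have "d = Min {c\<in>D. 2 ^ j \<le> c}" if "\<not> d < 2 ^ j"
      proof (rule Min_eqI[symmetric])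
        show "d \<le> c" if "c \<in> {c\<in>D. 2 ^ j \<le> c}" for c using that a_ge[of c] j by fastforce
      qed (use fin that d in auto)
      ultimately have "d \<in> T" unfolding T_def using jJ by blast
      moreover have "log 2 (b - a - 1) \<le> log 2 b"
        using pos db by (subst log_le_cancel_iff) auto
      ultimately show ?thesis using fd gb by (simp add: u_def)
    qed
  next
    fix b assume "b \<in> D"
    then show "0 \<le> g b" using g[of b] sub by (force intro: order_trans[of 0 "log 2 b"])
  qed
  \<comment> \<open>The uncharged maximum costs \<open>log 2 m + 1\<close> and the exempt elements
    cost \<open>2 * log 2 m + 2\<close>; together these are the error term.\<close>
  moreover have "f (Max D) + u (Max D) \<le> log 2 m + 1"
    using f_max[of "Max D"] fin ne by (auto simp: u_def intro: add_mono)
  moreover have "card D - card T \<le> sum u D"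
  proof -
    have "sum u D = card (D - T)"
      using fin by (simp add: u_def sum.If_cases Diff_eq)
    moreover have "card D - card T \<le> card (D - T)"
      by (rule diff_card_le_card_Diff) (simp add: T_def finJ)
    ultimately show ?thesis by simp
  qed
  ultimately show ?thesis using cT by (simp add: sum.distrib)
qed

section \<open>The potential\<close>

definition seg :: "int \<Rightarrow> int \<Rightarrow> int set" where
  "seg x y = {min x y..max x y}"

text \<open>The default 0 encodes an untouched column, as all rows in use are at least 1.\<close>

definition last_touch :: "point set \<Rightarrow> int \<Rightarrow> int" where
  "last_touch Z x = Max (insert 0 {y. (x, y) \<in> Z})"

text \<open>Strictness settles ties in favour of the column nearer to \<open>k\<close>, which blocks
  the farther one.\<close>

definition stairs :: "int \<Rightarrow> (int \<Rightarrow> int) \<Rightarrow> int \<Rightarrow> int set" where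
  "stairs m \<tau> k = {x\<in>{1..m}. x \<noteq> k \<and> 0 < \<tau> x \<and> (\<forall>z\<in>seg k x - {x}. \<tau> z < \<tau> x)}"

text \<open>Untouched columns (\<open>\<tau> x = 0\<close>) get the largest possible neighbourhood, so that inserting a
  key never increases the potential.\<close>

definition nbhd :: "int \<Rightarrow> (int \<Rightarrow> int) \<Rightarrow> int \<Rightarrow> int set" where
  "nbhd m \<tau> x = {y\<in>{1..m}. \<tau> x = 0 \<or> (\<forall>z\<in>seg x y - {x}. \<tau> z < \<tau> x)}"

definition potential :: "int \<Rightarrow> (int \<Rightarrow> int) \<Rightarrow> real" where
  "potential m \<tau> = (\<Sum>x\<in>{1..m}. log 2 (card (nbhd m \<tau> x)))"

lemma finite_nbhd: "finite (nbhd m \<tau> x)"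
  by (rule finite_subset[of _ "{1..m}"]) (auto simp: nbhd_def)

lemma finite_stairs: "finite (stairs m \<tau> k)"
  by (rule finite_subset[of _ "{1..m}"]) (auto simp: stairs_def)

lemma card_nbhd_pos:
  assumes "x \<in> {1..m}" shows "card (nbhd m \<tau> x) \<ge> 1"
proof -
  have "x \<in> nbhd m \<tau> x" using assms by (auto simp: nbhd_def seg_def)
  then show ?thesis using finite_nbhd by (metis One_nat_def Suc_leI card_gt_0_iff empty_iff)
qed

lemma card_nbhd_le: "card (nbhd m \<tau> x) \<le> nat m"
proof -
  have "nbhd m \<tau> x \<subseteq> {1..m}" by (auto simp: nbhd_def)
  then show ?thesis using card_mono[of "{1..m}" "nbhd m \<tau> x"] by simp
qed

lemma log_card_nbhd_le:
  assumes "x \<in> {1..m}" shows "log 2 (card (nbhd m \<tau> x)) \<le> log 2 m"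
proof -
  have "real (card (nbhd m \<tau> x)) \<le> m" using card_nbhd_le[of m \<tau> x] assms by auto
  then show ?thesis using card_nbhd_pos[OF assms, of \<tau>] assms
    by (subst log_le_cancel_iff) auto
qed

text \<open>An instance of \<open>sum_log_gaps_le\<close> with the new logarithms as
  \<open>f\<close> and the old ones as \<open>g\<close>. The sign \<open>e\<close> selects the side
  of \<open>k\<close>, so that both directions are treated at once.\<close>

lemma side_potential:
  fixes e k m s :: int and \<tau> :: "int \<Rightarrow> int"
  assumes e: "e = 1 \<or> e = -1" and k: "k \<in> {1..m}" and s: "0 < s"
  defines "S \<equiv> stairs m \<tau> k"
  defines "\<tau>' \<equiv> \<lambda>x. if x \<in> insert k S then s else \<tau> x"
  defines "D \<equiv> {d. 0 < d \<and> k + e * d \<in> S}"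
  shows "(\<Sum>d\<in>D. log 2 (card (nbhd m \<tau>' (k + e * d)))) + card D
    \<le> (\<Sum>d\<in>D. log 2 (card (nbhd m \<tau> (k + e * d)))) + 3 * log 2 m + 3"
proof (rule sum_log_gaps_le)
  show "D \<subseteq> {1..m}" using e k unfolding D_def S_def stairs_def by auto
  show "m \<ge> 1" using k by auto
  show "log 2 (card (nbhd m \<tau>' (k + e * d))) \<le> log 2 m" if "d \<in> D" for d
    using that by (intro log_card_nbhd_le) (auto simp: D_def S_def stairs_def)
next
  fix a d b assume a: "a \<in> insert 0 D" and d: "d \<in> D" and b: "b \<in> D" and ad: "a < d" and db: "d < b"
  let ?x = "k + e * d"
  \<comment> \<open>The case \<open>a = 0\<close> is column \<open>k\<close> itself, which also
    receives time \<open>s\<close>. These ties at \<open>s\<close> confine the new neighbourhood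
    strictly between the two adjacent touched columns.\<close>
  have ta: "\<tau>' (k + e * a) = s" and tb: "\<tau>' (k + e * b) = s" and td: "\<tau>' ?x = s"
    using a b d by (auto simp: \<tau>'_def D_def)
  have "nbhd m \<tau>' ?x \<subseteq> (\<lambda>c. k + e * c) ` {a<..<b}"
  proof
    fix y assume y: "y \<in> nbhd m \<tau>' ?x"
    define c where "c = e * (y - k)"
    have yc: "y = k + e * c" using e by (auto simp: c_def)
    have lt: "\<tau>' z < s" if "z \<in> seg ?x y - {?x}" for z
      using y that td s by (auto simp: nbhd_def)
    have "a < c"
    proof (rule ccontr)
      assume "\<not> a < c"
      then have "k + e * a \<in> seg ?x y - {?x}" using e ad yc by (auto simp: seg_def)
      then show False using lt ta by fastforce
    qed
    moreover have "c < b"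
    proof (rule ccontr)
      assume "\<not> c < b"
      then have "k + e * b \<in> seg ?x y - {?x}" using e db yc by (auto simp: seg_def)
      then show False using lt tb by fastforce
    qed
    ultimately show "y \<in> (\<lambda>c. k + e * c) ` {a<..<b}" using yc by auto
  qed
  then have "card (nbhd m \<tau>' ?x) \<le> card {a<..<b}"
    by (meson card_image_le card_mono finite_greaterThanLessThan_int finite_imageI le_trans)
  then have "real (card (nbhd m \<tau>' ?x)) \<le> b - a - 1" using ad db by auto
  moreover have "card (nbhd m \<tau>' ?x) \<ge> 1"
    using d by (intro card_nbhd_pos) (auto simp: D_def S_def stairs_def)
  ultimately show "log 2 (card (nbhd m \<tau>' ?x)) \<le> log 2 (b - a - 1)"
    by (subst log_le_cancel_iff) auto
next
  fix b assume b: "b \<in> D"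
  let ?x = "k + e * b"
  have x: "?x \<in> stairs m \<tau> k" and b0: "b > 0" using b by (auto simp: D_def S_def)
  \<comment> \<open>A record exceeds everything on the way back to \<open>k\<close>, so its old
    neighbourhood contains these \<open>b\<close> columns.\<close>
  have "(\<lambda>c. k + e * c) ` {1..b} \<subseteq> nbhd m \<tau> ?x"
  proof
    fix y assume "y \<in> (\<lambda>c. k + e * c) ` {1..b}"
    then obtain c where c: "1 \<le> c" "c \<le> b" "y = k + e * c" by auto
    have "y \<in> {1..m}" using x c e k by (auto simp: stairs_def)
    moreover have "seg ?x y \<subseteq> seg k ?x" using c e by (auto simp: seg_def)
    ultimately show "y \<in> nbhd m \<tau> ?x" using x by (auto simp: nbhd_def stairs_def)
  qed
  then have "card ((\<lambda>c. k + e * c) ` {1..b}) \<le> card (nbhd m \<tau> ?x)"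
    by (intro card_mono finite_nbhd)
  moreover have "inj_on (\<lambda>c. k + e * c) {1..b}" using e by (auto simp: inj_on_def)
  ultimately have "b \<le> card (nbhd m \<tau> ?x)" by (simp add: card_image)
  then have "real_of_int b \<le> card (nbhd m \<tau> ?x)" by linarith
  then show "log 2 b \<le> log 2 (card (nbhd m \<tau> ?x))"
    using b0 by (subst log_le_cancel_iff) auto
qed

text \<open>Both sides of \<open>k\<close> contribute \<open>3 * log 2 m + 3\<close> each. Columns
  outside \<open>S\<close> cannot gain potential: \<open>k\<close> was untouched and had the full
  neighbourhood, and the others keep their time while no other time decreases.\<close>

lemma potential_step:
  fixes k m s :: int and \<tau> :: "int \<Rightarrow> int"
  assumes k: "k \<in> {1..m}" and s: "0 < s" and tk: "\<tau> k = 0"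
    and t: "\<And>x. \<tau> x < s" "\<And>x. 0 \<le> \<tau> x"
  defines "S \<equiv> stairs m \<tau> k"
  defines "\<tau>' \<equiv> \<lambda>x. if x \<in> insert k S then s else \<tau> x"
  shows "potential m \<tau>' + card S \<le> potential m \<tau> + 6 * log 2 m + 6"
proof -
  define f where "f x = log 2 (card (nbhd m \<tau>' x))" for x
  define g where "g x = log 2 (card (nbhd m \<tau> x))" for x
  define D where "D e = {d. 0 < d \<and> k + e * d \<in> S}" for e :: int
  have finS: "finite S" by (simp add: S_def finite_stairs)
  have S: "S = (\<lambda>d. k + d) ` D 1 \<union> (\<lambda>d. k - d) ` D (-1)"
  proof -
    have "x \<in> (\<lambda>d. k + d) ` D 1 \<union> (\<lambda>d. k - d) ` D (-1)" if "x \<in> S" for x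
    proof (cases "x > k")
      case True
      then have "x - k \<in> D 1" using that by (auto simp: D_def)
      then show ?thesis by force
    next
      case False
      moreover have "x \<noteq> k" using that by (auto simp: S_def stairs_def)
      ultimately have "k - x \<in> D (-1)" using that by (auto simp: D_def)
      then show ?thesis by force
    qed
    then show ?thesis by (auto simp: D_def)
  qed
  have finD: "finite (D 1)" "finite (D (-1))"
  proof -
    have "D 1 = (\<lambda>x. x - k) ` {x\<in>S. x > k}" "D (-1) = (\<lambda>x. k - x) ` {x\<in>S. x < k}"
      by (force simp: D_def image_iff)+
    then show "finite (D 1)" "finite (D (-1))" using finS by simp_all
  qed
  have dis: "(\<lambda>d. k + d) ` D 1 \<inter> (\<lambda>d. k - d) ` D (-1) = {}" by (auto simp: D_def)
  have sumS: "sum h S = (\<Sum>d\<in>D 1. h (k + 1 * d)) + (\<Sum>d\<in>D (-1). h (k + (-1) * d))"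
    for h :: "int \<Rightarrow> real"
    using S finD dis by (simp add: sum.union_disjoint sum.reindex inj_on_def)
  have cS: "card S = card (D 1) + card (D (-1))"
    using S finD dis by (simp add: card_Un_disjoint card_image inj_on_def)
  have side: "(\<Sum>d\<in>D e. f (k + e * d)) + card (D e) \<le> (\<Sum>d\<in>D e. g (k + e * d)) + 3 * log 2 m + 3"
    if "e = 1 \<or> e = -1" for e
    using side_potential[OF that k s, of \<tau>] by (simp add: f_def g_def D_def S_def \<tau>'_def)
  have onS: "sum f S + card S \<le> sum g S + 6 * log 2 m + 6"
    using side[of 1] side[of "-1"] sumS[of f] sumS[of g] cS by linarith
  have off: "f x \<le> g x" if x: "x \<in> {1..m} - S" for x
  proof -
    have "nbhd m \<tau>' x \<subseteq> nbhd m \<tau> x"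
    proof (cases "x = k")
      case True
      then show ?thesis using tk by (auto simp: nbhd_def)
    next
      case False
      then have "\<tau>' x = \<tau> x" using x by (simp add: \<tau>'_def)
      moreover have "\<tau> z \<le> \<tau>' z" for z using t(1)[of z] by (simp add: \<tau>'_def)
      ultimately show ?thesis by (fastforce simp: nbhd_def intro: le_less_trans)
    qed
    then have "card (nbhd m \<tau>' x) \<le> card (nbhd m \<tau> x)" by (intro card_mono finite_nbhd)
    then show ?thesis using card_nbhd_pos[of x m \<tau>'] x
      unfolding f_def g_def by (subst log_le_cancel_iff) auto
  qed
  have "S \<subseteq> {1..m}" by (auto simp: S_def stairs_def)
  then have split: "sum h {1..m} = sum h ({1..m} - S) + sum h S" for h :: "int \<Rightarrow> real"
    by (simp add: sum.subset_diff)
  have "sum f ({1..m} - S) \<le> sum g ({1..m} - S)" using off by (rule sum_mono)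
  then show ?thesis unfolding potential_def f_def[symmetric] g_def[symmetric]
    using onS split[of f] split[of g] by linarith
qed

section \<open>GreedyArb\<close>

lemma finite_column: "finite Z \<Longrightarrow> finite {y. (x, y) \<in> (Z :: point set)}"
  by (rule finite_subset[of _ "snd ` Z"]) (auto simp: rev_image_eqI)

lemma last_touch_ge: "\<lbrakk>finite Z; (x, y) \<in> Z\<rbrakk> \<Longrightarrow> y \<le> last_touch Z x"
  unfolding last_touch_def using finite_column by (intro Max_ge) auto

lemma last_touch_nonneg: "finite Z \<Longrightarrow> 0 \<le> last_touch Z x"
  unfolding last_touch_def using finite_column by (intro Max_ge) auto

lemma last_touch_cases:
  assumes "finite Z" shows "last_touch Z x = 0 \<or> (x, last_touch Z x) \<in> Z"
proof -
  have "last_touch Z x \<in> insert 0 {y. (x, y) \<in> Z}"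
    unfolding last_touch_def using finite_column[OF assms] by (intro Max_in) auto
  then show ?thesis by auto
qed

text \<open>A column on the way from \<open>k\<close> to \<open>x\<close> meets the rectangle
  exactly when its topmost point is at least as high as the corner. Hence only the top point of a
  record column spans an empty rectangle with \<open>(k, s)\<close>.\<close>

lemma greedy_row_eq_stairs:
  assumes fin: "finite Z" and Z: "Z \<subseteq> {1..m} \<times> {1..<s}"
  shows "greedy_row Z (k, s) = (\<lambda>x. (x, s)) ` stairs m (last_touch Z) k" (is "?L = ?R")
proof
  let ?t = "last_touch Z"
  have t_lt: "?t z < s" if "?t z > 0" for z using last_touch_cases[OF fin, of z] Z that by auto
  show "?L \<subseteq> ?R"
  proof
    fix r assume "r \<in> ?L"
    then obtain x y where q: "(x, y) \<in> Z" "x \<noteq> k" "r = (x, s)"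
      and emp: "rect (k, s) (x, y) \<inter> (Z \<union> {(k, s)}) \<subseteq> {(k, s), (x, y)}"
      unfolding greedy_row_def by auto
    have y: "1 \<le> y" "y < s" "x \<in> {1..m}" using q Z by auto
    have ty: "y \<le> ?t x" using last_touch_ge fin q by blast
    have "\<forall>z\<in>seg k x - {x}. ?t z < ?t x"
    proof (intro ballI, rule ccontr)
      fix z assume z: "z \<in> seg k x - {x}" and "\<not> ?t z < ?t x"
      then have le: "y \<le> ?t z" using ty by linarith
      then have zZ: "(z, ?t z) \<in> Z" using last_touch_cases[OF fin, of z] y by auto
      moreover have lt: "?t z < s" using zZ Z by auto
      ultimately have "(z, ?t z) \<in> rect (k, s) (x, y) \<inter> (Z \<union> {(k, s)})"
        using z le by (auto simp: rect_def seg_def)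
      then have "(z, ?t z) \<in> {(k, s), (x, y)}" using emp by blast
      then show False using z lt by auto
    qed
    then show "r \<in> ?R" using q y ty by (auto simp: stairs_def)
  qed
  show "?R \<subseteq> ?L"
  proof
    fix r assume "r \<in> ?R"
    then obtain x where x: "r = (x, s)" "x \<in> {1..m}" "x \<noteq> k" "0 < ?t x"
      and lt: "\<forall>z\<in>seg k x - {x}. ?t z < ?t x"
      by (auto simp: stairs_def)
    have xZ: "(x, ?t x) \<in> Z" using last_touch_cases[OF fin, of x] x by auto
    have "rect (k, s) (x, ?t x) \<inter> (Z \<union> {(k, s)}) \<subseteq> {(k, s), (x, ?t x)}"
    proof
      fix q assume q: "q \<in> rect (k, s) (x, ?t x) \<inter> (Z \<union> {(k, s)})"
      obtain z y where qzy: "q = (z, y)" by fastforce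
      show "q \<in> {(k, s), (x, ?t x)}"
      proof (cases "q = (k, s)")
        case False
        then have "(z, y) \<in> Z" using q qzy by auto
        then have "y \<le> ?t z" using last_touch_ge fin by blast
        moreover have "z \<in> seg k x" "?t x \<le> y"
          using q qzy t_lt[OF x(4)] by (auto simp: rect_def seg_def)
        moreover from calculation have "z = x" using lt
          by (meson DiffI empty_iff insertE leD order_trans)
        ultimately have "z = x \<and> y = ?t x" by simp
        then show ?thesis using qzy by simp
      qed simp
    qed
    then show "r \<in> ?L" unfolding greedy_row_def using xZ x by force
  qed
qed

lemma last_touch_update:
  assumes fin: "finite Z" "finite A" and Z: "Z \<subseteq> {1..m} \<times> {1..<s}" and s: "0 < s"
  shows "last_touch (Z \<union> (\<lambda>x. (x, s)) ` A) = (\<lambda>x. if x \<in> A then s else last_touch Z x)"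
proof
  fix x
  show "last_touch (Z \<union> (\<lambda>x. (x, s)) ` A) x = (if x \<in> A then s else last_touch Z x)"
  proof (cases "x \<in> A")
    case True
    have "{y. (x, y) \<in> Z \<union> (\<lambda>x. (x, s)) ` A} = insert s {y. (x, y) \<in> Z}" using True by auto
    moreover have "Max (insert 0 (insert s {y. (x, y) \<in> Z})) = s"
      using finite_column[OF fin(1)] Z s by (intro Max_eqI) auto
    ultimately show ?thesis using True by (simp add: last_touch_def)
  next
    case False
    then have "{y. (x, y) \<in> Z \<union> (\<lambda>x. (x, s)) ` A} = {y. (x, y) \<in> Z}" by auto
    then show ?thesis using False by (simp add: last_touch_def)
  qed
qed

section \<open>Amortized cost of GreedyArb\<close>

lemma greedy_row_potential:
  assumes fin: "finite Z" and Z: "Z \<subseteq> {1..m} \<times> {1..<s}" and s: "0 < s"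
    and k: "k \<in> {1..m}" "k \<notin> fst ` Z"
  shows "potential m (last_touch (insert (k, s) (Z \<union> greedy_row Z (k, s)))) + card (greedy_row Z (k, s))
    \<le> potential m (last_touch Z) + 6 * log 2 m + 6"
proof -
  let ?S = "stairs m (last_touch Z) k"
  have row: "greedy_row Z (k, s) = (\<lambda>x. (x, s)) ` ?S" by (rule greedy_row_eq_stairs[OF fin Z])
  have upd: "insert (k, s) (Z \<union> greedy_row Z (k, s)) = Z \<union> (\<lambda>x. (x, s)) ` insert k ?S"
    using row by auto
  have finS: "finite (insert k ?S)" by (simp add: finite_stairs)
  have "last_touch Z k = 0" using last_touch_cases[OF fin, of k] k by force
  moreover have "last_touch Z x < s" for x using last_touch_cases[OF fin, of x] Z s by auto
  ultimately have "potential m (\<lambda>x. if x \<in> insert k ?S then s else last_touch Z x) + card ?S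
      \<le> potential m (last_touch Z) + 6 * log 2 m + 6"
    using k s fin by (intro potential_step last_touch_nonneg) auto
  then show ?thesis
    unfolding upd last_touch_update[OF fin finS Z s] unfolding row by (simp add: card_image inj_on_def)
qed

text \<open>Induction over the accesses. The inclusion of the columns is part of the invariant
  because it shows that the column of the next key is still untouched.\<close>

lemma greedy_added_bound:
  fixes t :: "nat \<Rightarrow> nat"
  assumes n: "n \<ge> 1" and bij: "bij_betw t {1..n} {1..n}" and X: "X = perm_points n t"
    and j: "j \<le> n"
  defines "A \<equiv> \<lambda>j. {q\<in>X. snd q \<le> int j} \<union> greedy_added X j"
  shows "finite (A j) \<and> A j \<subseteq> {1..int n} \<times> {1..int j} \<and> fst ` A j \<subseteq> fst ` {q\<in>X. snd q \<le> int j}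
    \<and> potential n (last_touch (A j)) + card (greedy_added X j) \<le> n * log 2 n + j * (6 * log 2 n + 6)"
  using j
proof (induction j)
  case 0
  have A0: "A 0 = {}" using bij unfolding A_def X perm_points_def
    by (auto dest: bij_betw_apply)
  \<comment> \<open>Initially all neighbourhoods are full, whence the starting potential
    \<open>n * log 2 n\<close>.\<close>
  have "nbhd n (last_touch {}) x = {1..int n}" for x
    by (auto simp: nbhd_def last_touch_def)
  then show ?case by (simp add: A0 potential_def)
next
  case (Suc j)
  let ?s = "int (Suc j)"
  have "Suc j \<in> t ` {1..n}" using bij Suc.prems by (simp add: bij_betw_def)
  then obtain i where i: "i \<in> {1..n}" "t i = Suc j" by fastforce
  have inj: "inj_on t {1..n}" using bij by (simp add: bij_betw_def)
  have uniq: "x = i" if "x \<in> {1..n}" "t x = Suc j" for x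
    using inj_onD[OF inj, of x i] i that by simp
  have pX: "p \<in> X \<and> snd p = ?s \<longleftrightarrow> p = (int i, ?s)" for p
  proof
    assume "p \<in> X \<and> snd p = ?s"
    then obtain x where x: "x \<in> {1..n}" "p = (int x, int (t x))" "int (t x) = ?s"
      unfolding X perm_points_def by auto
    then have "t x = Suc j" by simp
    then show "p = (int i, ?s)" using uniq x by simp
  next
    assume "p = (int i, ?s)"
    then show "p \<in> X \<and> snd p = ?s" using i unfolding X perm_points_def by force
  qed
  have the_p: "(THE p. p \<in> X \<and> snd p = ?s) = (int i, ?s)" unfolding pX by simp
  let ?Z = "A j"
  let ?R = "greedy_row ?Z (int i, ?s)"
  have Zeq: "{q \<in> X. snd q < ?s} \<union> greedy_added X j = ?Z" by (auto simp: A_def)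
  have added: "greedy_added X (Suc j) = greedy_added X j \<union> ?R"
    unfolding greedy_added.simps(2) Let_def the_p Zeq ..
  have Xsplit: "{q\<in>X. snd q \<le> ?s} = insert (int i, ?s) {q\<in>X. snd q \<le> int j}"
    using pX by (auto simp: le_less)
  have ASuc: "A (Suc j) = insert (int i, ?s) (?Z \<union> ?R)"
    unfolding A_def added Xsplit by (auto simp: A_def)
  have IH: "finite ?Z" "?Z \<subseteq> {1..int n} \<times> {1..int j}" "fst ` ?Z \<subseteq> fst ` {q\<in>X. snd q \<le> int j}"
    "potential n (last_touch ?Z) + card (greedy_added X j) \<le> n * log 2 n + j * (6 * log 2 n + 6)"
    using Suc by auto
  have Z: "?Z \<subseteq> {1..int n} \<times> {1..<?s}" using IH(2) by auto
  \<comment> \<open>Column \<open>i\<close> contains only one point of \<open>X\<close>, in row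
    \<open>Suc j\<close>, so no earlier access was to this key.\<close>
  have iZ: "int i \<notin> fst ` ?Z"
  proof
    assume "int i \<in> fst ` ?Z"
    then have "int i \<in> fst ` {q\<in>X. snd q \<le> int j}" using IH(3) by blast
    then show False using i by (auto simp: X perm_points_def)
  qed
  have step: "potential n (last_touch (A (Suc j))) + card ?R
      \<le> potential n (last_touch ?Z) + 6 * log 2 n + 6"
    unfolding ASuc using greedy_row_potential[OF IH(1) Z _ _ iZ] i by simp
  have R: "fst ` ?R \<subseteq> fst ` ?Z" "snd ` ?R \<subseteq> {?s}" "finite ?R"
  proof -
    show "fst ` ?R \<subseteq> fst ` ?Z" "snd ` ?R \<subseteq> {?s}"
      by (force simp: greedy_row_def simp del: split_paired_Ex)+
    show "finite ?R" unfolding greedy_row_eq_stairs[OF IH(1) Z] by (simp add: finite_stairs)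
  qed
  have "card (greedy_added X (Suc j)) \<le> card (greedy_added X j) + card ?R"
    unfolding added by (rule card_Un_le)
  then have "potential n (last_touch (A (Suc j))) + card (greedy_added X (Suc j))
      \<le> n * log 2 n + Suc j * (6 * log 2 n + 6)"
    using step IH(4) by (simp add: algebra_simps)
  moreover have "finite (A (Suc j))" unfolding ASuc using IH(1) R(3) by simp
  moreover have "fst ` A (Suc j) \<subseteq> fst ` {q\<in>X. snd q \<le> ?s}"
    unfolding ASuc Xsplit using IH(3) R(1) by (simp add: image_Un) blast
  moreover have "A (Suc j) \<subseteq> {1..int n} \<times> {1..?s}"
  proof -
    have "fst ` ?Z \<subseteq> {1..int n}" "snd ` ?Z \<subseteq> {1..int j}" using IH(2) by auto
    moreover have "{1..int j} \<subseteq> {1..?s}" by auto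
    ultimately have "fst ` A (Suc j) \<subseteq> {1..int n}" "snd ` A (Suc j) \<subseteq> {1..?s}"
      unfolding ASuc image_insert image_Un using i R(1,2) by auto
    then show ?thesis by (force simp: subset_iff)
  qed
  ultimately show ?case by blast
qed

theorem theorem1:
  shows "\<exists>c::real. c > 0 \<and>
    (\<forall>(n::nat) (t::nat \<Rightarrow> nat) (X::point set) (Y'::point set).
       n \<ge> 2 \<and> bij_betw t {1..n} {1..n} \<and> X = perm_points n t \<and> is_MinArb X Y' \<longrightarrow>
       real (card X) + real (card (GreedyArb X))
         \<le> c * ln (real n) * (real (card X) + real (card Y')))"
\<comment> \<open>14 = 1 + 1 + 6 + 6: the size of \<open>X\<close>, the initial potential and the
  two terms per access, each linear term bounded through \<open>1 \<le> log 2 n\<close>. The factor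
  \<open>1 / ln 2\<close> changes the base of the logarithm.\<close>
proof (intro exI[of _ "14 / ln 2"] conjI allI impI)
  show "14 / ln 2 > (0::real)" by simp
next
  fix n :: nat and t :: "nat \<Rightarrow> nat" and X Y' :: "point set"
  assume "n \<ge> 2 \<and> bij_betw t {1..n} {1..n} \<and> X = perm_points n t \<and> is_MinArb X Y'"
  then have n: "n \<ge> 2" and bij: "bij_betw t {1..n} {1..n}" and X: "X = perm_points n t" by auto
  have cX: "card X = n" unfolding X perm_points_def by (simp add: card_image inj_on_def)
  let ?A = "{q\<in>X. snd q \<le> int n} \<union> greedy_added X n"
  have "potential n (last_touch ?A) \<ge> 0"
    unfolding potential_def
  proof (rule sum_nonneg)
    fix x assume "x \<in> {1..int n}"
    from card_nbhd_pos[OF this, of "last_touch ?A"]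
    show "0 \<le> log 2 (card (nbhd (int n) (last_touch ?A) x))" by (simp add: zero_le_log_cancel_iff)
  qed
  then have "card (GreedyArb X) \<le> n * log 2 n + n * (6 * log 2 n + 6)"
    using greedy_added_bound[OF _ bij X order_refl] n unfolding GreedyArb_def cX by simp
  moreover have "1 \<le> log 2 n" using n by (simp add: le_log_iff)
  then have "real n \<le> n * log 2 n" using n by simp
  ultimately have "card X + card (GreedyArb X) \<le> 14 * log 2 n * n"
    unfolding cX by (simp add: algebra_simps)
  also have "\<dots> \<le> 14 * log 2 n * (card X + card Y')"
    unfolding cX using n by (intro mult_left_mono) auto
  also have "14 * log 2 n = 14 / ln 2 * ln n" by (simp add: log_def)
  finally show "real (card X) + real (card (GreedyArb X))
      \<le> 14 / ln 2 * ln (real n) * (real (card X) + real (card Y'))" by simp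
qed

end
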